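(* Let $\phi=f+r$ and $\phi_\eta=f_\eta+r$ on $\mathbb{R}^d$, where $f:\mathbb{R}^d\to\mathbb{R}$ is $\rho$-weakly convex ($\rho>0$), $r:\mathbb{R}^d\to(-\infty,+\infty]$ is proper, convex, lower semicontinuous and bounded below, and $f_\eta$ is a $(\bar\rho,\mathcal{R}_\eta,\mathcal{L}_\eta)$-smooth approximation of $f$ on a closed convex set $\mathcal{X}\supseteq\operatorname{dom} r$. Let $x\in\operatorname{dom}\phi$. 1) Let $\gamma>0$, $\hat x:=\operatorname{prox}_{\gamma r}(x-\gamma\nabla f_\eta(x))$ and $\mathcal{G}_\gamma(x):=\frac1\gamma(x-\hat x)$. If $\|\mathcal{G}_\gamma(x)\|\le\varepsilon$ for some $\varepsilon>0$, then for every $\hat\rho>\max\{\rho,\bar\rho\}$, $x$ is a $$\left(\sqrt{\tfrac{2\mathcal{R}_\eta(\hat x)}{\hat\rho-\rho}}+\gamma\varepsilon,\ \bigl(1+\gamma\mathcal{L}_\eta(x,\hat x)\bigr)\varepsilon+\hat\rho\sqrt{\tfrac{2\mathcal{R}_\eta(\hat x)}{\hat\rho-\rho}}\right)\text{-stationary point of }\min_x\phi(x).$$ 2) Let $\beta>\max\{\rho,\bar\rho\}$ and $y_x:=\operatorname{prox}_{\phi_\eta/\beta}(x)$. If $\|\nabla\phi_\eta^\beta(x)\|\le\varepsilon$, then $x$ is a $$\left(\sqrt{\tfrac{2\mathcal{R}_\eta(y_x)}{\beta-\rho}}+\beta^{-1}\varepsilon,\ \beta\sqrt{\tfrac{2\mathcal{R}_\eta(y_x)}{\beta-\rho}}+\varepsilon\right)\text{-stationary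 point of }\min_x\phi(x).$$
   Context: $\|\cdot\|$ is the Euclidean norm. A function $g$ is $\rho$-weakly convex (on a convex set) if $g+\frac\rho2\|\cdot\|^2$ is convex (on that set). $\partial$ denotes the Fréchet (= limiting, for weakly convex functions) subdifferential, and $\|S\|:=\operatorname{dist}(0,S)$ for a set $S$. Smooth approximation: a continuously differentiable $f_\eta$ (indexed by a parameter $\eta>0$) is a $(\bar\rho,\mathcal{R}_\eta,\mathcal{L}_\eta)$-smooth approximation of $f$ on $\mathcal{X}$, where $\bar\rho>0$ is a constant not depending on $\eta$, $\mathcal{R}_\eta:\mathcal{X}\to[0,\infty)$ and $\mathcal{L}_\eta:\mathcal{X}\times\mathcal{X}\to[0,\infty)$ is symmetric, if $f_\eta$ is $\bar\rho$-weakly convex, $f_\eta(x)\le f(x)\le f_\eta(x)+\mathcal{R}_\eta(x)$ for all $x\in\mathcal{X}$, and $\|\nabla f_\eta(x)-\nabla f_\eta(y)\|\le\mathcal{L}_\eta(x,y)\|x-y\|$ for all $x,y\in\mathcal{X}$. Proximal operator and Moreau envelope: $\operatorname{prox}_{g/\beta}(x)=\arg\min_y\{g(y)+\frac\beta2\|y-x\|^2\}$, $\operatorname{prox}_{\gamma r}(x)=\arg\min_y\{r(y)+\frac1{2\gamma}\|y-x\|^2\}$, and $g^\beta(x)=\min_y\{g(y)+\frac\beta2\|y-x\|^2\}$; for $\bar\rho$-weakly convex $g$ and $\beta>\bar\rho$, $\nabla g^\beta(x)=\beta(x-\operatorname{prox}_{g/\beta}(x))$. Approximate stationarity: $x$ is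 a $(\delta,\varepsilon')$-stationary point of $\min\phi$ if there is $\hat y\in\operatorname{dom}\phi$ with $\|\hat y-x\|\le\delta$ and $\|\partial\phi(\hat y)\|\le\varepsilon'$. *)

theory Defs
  imports "HOL-Analysis.Analysis"
begin

definition weakly_convex_on :: "real \<Rightarrow> 'a::euclidean_space set \<Rightarrow> ('a \<Rightarrow> real) \<Rightarrow> bool" where
  "weakly_convex_on \<rho> S g \<longleftrightarrow> convex_on S (\<lambda>x. g x + \<rho> / 2 * (norm x)\<^sup>2)"

(* Only meaningful where g is differentiable; see GDERIV. *)
definition grad :: "('a::euclidean_space \<Rightarrow> real) \<Rightarrow> 'a \<Rightarrow> 'a" where
  "grad g x = (THE D. GDERIV g x :> D)"

definition continuously_differentiable :: "('a::euclidean_space \<Rightarrow> real) \<Rightarrow> bool" where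
  "continuously_differentiable g \<longleftrightarrow>
     (\<forall>x. GDERIV g x :> grad g x) \<and> continuous_on UNIV (grad g)"

(* The error function R and the modulus L are total functions of which only
   the values on X matter. Weak convexity is required on X only. *)
definition smooth_approximation ::
  "real \<Rightarrow> ('a::euclidean_space \<Rightarrow> real) \<Rightarrow> ('a \<Rightarrow> 'a \<Rightarrow> real) \<Rightarrow> 'a set \<Rightarrow>
   ('a \<Rightarrow> real) \<Rightarrow> ('a \<Rightarrow> real) \<Rightarrow> bool" where
  "smooth_approximation \<rho>' R L X f' f \<longleftrightarrow>
     \<rho>' > 0 \<and>
     (\<forall>x\<in>X. R x \<ge> 0) \<and>
     (\<forall>x\<in>X. \<forall>y\<in>X. L x y \<ge> 0 \<and> L x y = L y x) \<and>
     continuously_differentiable f' \<and>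
     weakly_convex_on \<rho>' X f' \<and>
     (\<forall>x\<in>X. f' x \<le> f x \<and> f x \<le> f' x + R x) \<and>
     (\<forall>x\<in>X. \<forall>y\<in>X. norm (grad f' x - grad f' y) \<le> L x y * norm (x - y))"

definition effective_domain :: "('a \<Rightarrow> ereal) \<Rightarrow> 'a set" where
  "effective_domain g = {x. g x < \<infinity>}"

definition proper :: "('a \<Rightarrow> ereal) \<Rightarrow> bool" where
  "proper g \<longleftrightarrow> (\<forall>x. g x \<noteq> -\<infinity>) \<and> effective_domain g \<noteq> {}"

(* Intended for g > -\<infinity>. The library convention 0 * \<infinity> = 0 makes the cases
   u = 0 and v = 0 trivial. *)
definition convex_ereal :: "('a::real_vector \<Rightarrow> ereal) \<Rightarrow> bool" where
  "convex_ereal g \<longleftrightarrow>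
     (\<forall>x y. \<forall>u\<ge>0. \<forall>v\<ge>0. u + v = 1 \<longrightarrow>
        g (u *\<^sub>R x + v *\<^sub>R y) \<le> ereal u * g x + ereal v * g y)"

definition lower_semicontinuous :: "('a::topological_space \<Rightarrow> ereal) \<Rightarrow> bool" where
  "lower_semicontinuous g \<longleftrightarrow> (\<forall>x. g x \<le> Liminf (at x) g)"

definition bounded_below :: "('a \<Rightarrow> ereal) \<Rightarrow> bool" where
  "bounded_below g \<longleftrightarrow> (\<exists>m::real. \<forall>x. ereal m \<le> g x)"

(* The Frechet subdifferential; empty outside the points where g is finite. *)
definition subdifferential :: "('a::euclidean_space \<Rightarrow> ereal) \<Rightarrow> 'a \<Rightarrow> 'a set" where
  "subdifferential g x =
     {v. \<bar>g x\<bar> \<noteq> \<infinity> \<and>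
         0 \<le> Liminf (at x) (\<lambda>y. (g y - g x - ereal (v \<bullet> (y - x))) / ereal (norm (y - x)))}"

(* Extended-real valued so that the empty set has distance \<infinity>; the library
   function infdist returns 0 for it. *)
definition dist_zero :: "'a::real_normed_vector set \<Rightarrow> ereal" where
  "dist_zero S = (INF v\<in>S. ereal (dist 0 v))"

(* prox \<gamma> g is the proximal operator of \<gamma> g; the operator of g/\<beta> is prox (1/\<beta>) g. *)
definition prox :: "real \<Rightarrow> ('a::euclidean_space \<Rightarrow> ereal) \<Rightarrow> 'a \<Rightarrow> 'a" where
  "prox \<gamma> g x = (ARG_MIN (\<lambda>y. g y + ereal (1 / (2 * \<gamma>) * (norm (y - x))\<^sup>2)) y. True)"

definition moreau_envelope :: "real \<Rightarrow> ('a::euclidean_space \<Rightarrow> ereal) \<Rightarrow> 'a \<Rightarrow> ereal" where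
  "moreau_envelope \<beta> g x = (INF y. g y + ereal (\<beta> / 2 * (norm (y - x))\<^sup>2))"

definition approx_stationary ::
  "real \<Rightarrow> real \<Rightarrow> ('a::euclidean_space \<Rightarrow> ereal) \<Rightarrow> 'a \<Rightarrow> bool" where
  "approx_stationary \<delta> \<epsilon> \<phi> x \<longleftrightarrow>
     (\<exists>y\<in>effective_domain \<phi>. norm (y - x) \<le> \<delta> \<and> dist_zero (subdifferential \<phi> y) \<le> ereal \<epsilon>)"

end

theory Submission
  imports Defs
begin

text \<open>The whole argument rests on one inequality for a proximal point \<open>y\<close> of \<open>g + r\<close> at \<open>p\<close>, with
  \<open>g\<close> weakly convex of modulus \<open>\<rho> < \<beta>\<close>: strong convexity of the proximal objective gives
  \<open>(g + r) z \<ge> (g + r) y + \<beta> * ((p - y) \<bullet> (z - y)) - \<rho>/2 * (norm (z - y))\<^sup>2\<close>.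
  It shows that \<open>\<beta> *\<^sub>R (p - y)\<close> is a subgradient at \<open>y\<close> and yields the gradient of the Moreau
  envelope. In both parts of the theorem it provides, at the proximal point of the smooth problem,
  a quadratic minorant of \<open>\<phi>\<^sub>\<eta>\<close> with slope \<open>w\<close>. Comparing this minorant with the inequality for \<open>\<phi>\<close>
  at a suitably shifted point produces a nearby point where \<open>\<phi>\<close> has a small subgradient.\<close>

section \<open>Lower semicontinuity and existence of minimizers\<close>

lemma closed_sublevel_lower_semicontinuous:
  fixes F :: "'a::topological_space \<Rightarrow> ereal"
  assumes "lower_semicontinuous F"
  shows "closed {z. F z \<le> a}"
proof -
  have "\<exists>T. open T \<and> x \<in> T \<and> T \<subseteq> {z. a < F z}" if "a < F x" for x
  proof -
    have "eventually (\<lambda>z. a < F z) (at x)"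
      using assms that unfolding lower_semicontinuous_def le_Liminf_iff by blast
    \<comment> \<open>The filter \<open>at x\<close> leaves out \<open>x\<close> itself; there the
      inequality is the assumption \<open>a < F x\<close>, so it holds on all of
      \<open>T\<close>.\<close>
    then obtain T where "open T" "x \<in> T" "\<forall>z\<in>T. z \<noteq> x \<longrightarrow> a < F z"
      unfolding eventually_at_topological by auto
    then show ?thesis
      using that by (intro exI[of _ T]) auto
  qed
  then have "open {z. a < F z}"
    by (subst open_subopen) auto
  moreover have "{z. F z \<le> a} = - {z. a < F z}"
    by auto
  ultimately show ?thesis
    by (simp add: closed_def)
qed

text \<open>Finite intersection property on the compact sublevel set \<open>K\<close>: finitely many
  closed sublevel sets with levels attained on \<open>K\<close> share the point of lowest level
  among them. A point common to all of them is a minimizer.\<close>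

lemma lower_semicontinuous_attains_inf:
  fixes F :: "'a::heine_borel \<Rightarrow> ereal"
  assumes lsc: "lower_semicontinuous F" and bdd: "bounded {z. F z \<le> F x}"
  shows "\<exists>y. \<forall>z. F y \<le> F z"
proof -
  define K where "K = {z. F z \<le> F x}"
  have "compact K"
    unfolding K_def compact_eq_bounded_closed
    using bdd closed_sublevel_lower_semicontinuous[OF lsc] by blast
  then have "K \<inter> (\<Inter>w\<in>K. {z. F z \<le> F w}) \<noteq> {}"
  proof (rule compact_imp_fip_image)
    show "closed {z. F z \<le> F w}" for w
      by (rule closed_sublevel_lower_semicontinuous[OF lsc])
  next
    fix I assume I: "finite I" "I \<subseteq> K"
    show "K \<inter> (\<Inter>w\<in>I. {z. F z \<le> F w}) \<noteq> {}"
    proof (cases "I = {}")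
      case True
      then show ?thesis by (auto simp: K_def)
    next
      case False
      then obtain v where v: "v \<in> I" "F v = Min (F ` I)"
        using I by (metis (mono_tags, lifting) Min_in finite_imageI image_iff image_is_empty)
      have "F v \<le> F w" if "w \<in> I" for w
        using v I that by simp
      then have "v \<in> K \<inter> (\<Inter>w\<in>I. {z. F z \<le> F w})"
        using v I by auto
      then show ?thesis by blast
    qed
  qed
  then obtain y where y: "y \<in> K" "\<And>w. w \<in> K \<Longrightarrow> F y \<le> F w"
    by auto
  have "F y \<le> F z" for z
  proof (cases "z \<in> K")
    case False
    then have "F x \<le> F z" by (simp add: K_def)
    with y(1) show ?thesis by (auto simp: K_def intro: order_trans)
  qed (rule y(2))
  then show ?thesis by blast
qed

text \<open>A real \<open>q\<close> is squeezed strictly between \<open>C - g x\<close> and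
  \<open>r x\<close>: near \<open>x\<close>, lower semicontinuity keeps \<open>r z\<close> above
  \<open>q\<close> and continuity keeps \<open>q + g z\<close> above \<open>C\<close>.\<close>

lemma lower_semicontinuous_add_continuous:
  fixes r :: "'a::topological_space \<Rightarrow> ereal"
  assumes g: "continuous_on UNIV g" and r: "lower_semicontinuous r"
  shows "lower_semicontinuous (\<lambda>z. ereal (g z) + r z)"
  unfolding lower_semicontinuous_def le_Liminf_iff
proof (intro allI impI)
  fix x C assume C: "C < ereal (g x) + r x"
  then have "C - ereal (g x) < r x"
    by (cases C; cases "r x") auto
  then obtain q where q: "C - ereal (g x) < ereal q" "ereal q < r x"
    using ereal_dense2 by blast
  have "eventually (\<lambda>z. ereal q < r z) (at x)"
    using r q(2) unfolding lower_semicontinuous_def le_Liminf_iff by blast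
  moreover have "((\<lambda>z. ereal (q + g z)) \<longlongrightarrow> ereal (q + g x)) (at x)"
    using g by (auto intro!: tendsto_intros simp: continuous_on_def)
  then have "eventually (\<lambda>z. C < ereal (q + g z)) (at x)"
    by (rule order_tendstoD) (use q(1) in \<open>cases C; auto\<close>)
  ultimately show "eventually (\<lambda>z. C < ereal (g z) + r z) (at x)"
  proof eventually_elim
    case (elim z)
    have "ereal (q + g z) \<le> ereal (g z) + r z"
      using elim(1) by (cases "r z") auto
    with elim(2) show ?case by (rule less_le_trans)
  qed
qed

section \<open>Weakly convex functions: linear lower bound and gradient inequality\<close>

text \<open>Only the values of \<open>k\<close> on the unit sphere around \<open>x\<^sub>0\<close> and convexity along
  rays are used, so no subgradient (hence no interior point of \<open>D\<close>) is needed.\<close>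
lemma convex_on_linear_lower_bound:
  fixes k :: "'a::euclidean_space \<Rightarrow> real"
  assumes k: "convex_on D k" "continuous_on UNIV k" and x0: "x\<^sub>0 \<in> D"
  shows "\<exists>M\<ge>0. \<forall>z\<in>D. k z \<ge> - M - M * norm (z - x\<^sub>0)"
proof -
  have "bounded (k ` cball x\<^sub>0 1)"
    by (intro compact_imp_bounded compact_continuous_image compact_cball
        continuous_on_subset[OF k(2)]) auto
  then obtain B where B: "B > 0" "\<And>z. z \<in> cball x\<^sub>0 1 \<Longrightarrow> \<bar>k z\<bar> \<le> B"
    unfolding bounded_pos by auto
  have "k z \<ge> - (2*B) - (2*B) * norm (z - x\<^sub>0)" if z: "z \<in> D" for z
  proof (cases "norm (z - x\<^sub>0) \<le> 1")
    case True
    then have "\<bar>k z\<bar> \<le> B"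
      by (intro B(2)) (simp add: dist_norm norm_minus_commute)
    moreover have "0 \<le> (2*B) * norm (z - x\<^sub>0)"
      using B(1) by simp
    ultimately show ?thesis using B(1) by linarith
  next
    case False
    define u where "u = norm (z - x\<^sub>0)"
    have u: "u > 1" using False by (simp add: u_def)
    \<comment> \<open>The point where the ray from \<open>x\<^sub>0\<close> to \<open>z\<close>
      meets the unit sphere. Convexity at \<open>p\<close>, with \<open>k p\<close> bounded below
      and \<open>k x\<^sub>0\<close> bounded above, limits the decrease of \<open>k\<close> to a
      linear rate.\<close>
    define p where "p = (1 - 1/u) *\<^sub>R x\<^sub>0 + (1/u) *\<^sub>R z"
    have "p - x\<^sub>0 = (1/u) *\<^sub>R (z - x\<^sub>0)"
      by (simp add: p_def algebra_simps)
    then have "norm (p - x\<^sub>0) = 1"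
      using u by (simp add: u_def[symmetric])
    then have kp: "\<bar>k p\<bar> \<le> B"
      by (intro B(2)) (simp add: dist_norm norm_minus_commute)
    have kx: "\<bar>k x\<^sub>0\<bar> \<le> B"
      using B by simp
    have "k p \<le> (1 - 1/u) * k x\<^sub>0 + (1/u) * k z"
      unfolding p_def using u x0 z by (intro convex_onD[OF k(1)]) auto
    then have "u * k p \<le> u * ((1 - 1/u) * k x\<^sub>0 + (1/u) * k z)"
      using u by (intro mult_left_mono) auto
    moreover have "u * ((1 - 1/u) * k x\<^sub>0 + (1/u) * k z) = (u - 1) * k x\<^sub>0 + k z"
      using u by (simp add: algebra_simps)
    ultimately have "u * k p \<le> (u - 1) * k x\<^sub>0 + k z"
      by simp
    moreover have "u * k p \<ge> u * (- B)"
      using u kp by (intro mult_left_mono) auto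
    moreover have "(u - 1) * k x\<^sub>0 \<le> (u - 1) * B"
      using u kx by (intro mult_left_mono) auto
    ultimately have "k z \<ge> - 2 * (B * u)"
      using B(1) by (simp add: algebra_simps)
    then show ?thesis
      using B(1) by (simp add: u_def)
  qed
  moreover have "2 * B \<ge> 0"
    using B(1) by simp
  ultimately show ?thesis by blast
qed

text \<open>For the convexified function \<open>k\<close>, difference quotients along the segment
  from \<open>x\<close> to \<open>z\<close> stay below \<open>k z - k x\<close>. Letting
  \<open>t\<close> decrease to 0 gives the tangent inequality of \<open>k\<close>; removing the
  quadratic again leaves the stated loss. The limit is one-sided because \<open>x\<close> may lie on
  the boundary of \<open>S\<close>.\<close>

lemma weakly_convex_gradient_inequality:
  fixes g :: "'a::euclidean_space \<Rightarrow> real"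
  assumes g: "weakly_convex_on \<rho> S g" "GDERIV g x :> D" and x: "x \<in> S" and z: "z \<in> S"
  shows "g z \<ge> g x + D \<bullet> (z - x) - \<rho>/2 * (norm (z - x))\<^sup>2"
proof -
  define k where "k = (\<lambda>z. g z + \<rho>/2 * (norm z)\<^sup>2)"
  have cvx: "convex_on S k"
    using g(1) by (simp add: weakly_convex_on_def k_def)
  have dk: "(k has_derivative (\<lambda>h. h \<bullet> D + \<rho> * (x \<bullet> h))) (at x)"
    using g(2) unfolding k_def gderiv_def power2_norm_eq_inner
    by (auto intro!: derivative_eq_intros simp: inner_commute algebra_simps)
  have "((\<lambda>t. k (x + t *\<^sub>R (z - x))) has_derivative
      (\<lambda>t. (t *\<^sub>R (z - x)) \<bullet> D + \<rho> * (x \<bullet> (t *\<^sub>R (z - x))))) (at 0)"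
    by (rule has_derivative_compose[of "\<lambda>t. x + t *\<^sub>R (z - x)"])
      (use dk in \<open>auto intro!: derivative_eq_intros\<close>)
  then have "((\<lambda>t. k (x + t *\<^sub>R (z - x))) has_field_derivative
      ((z - x) \<bullet> D + \<rho> * (x \<bullet> (z - x)))) (at 0)"
    unfolding has_field_derivative_def
    by (rule has_derivative_eq_rhs) (auto simp: fun_eq_iff algebra_simps)
  then have "((\<lambda>t. (k (x + t *\<^sub>R (z - x)) - k x) / t) \<longlongrightarrow> (z - x) \<bullet> D + \<rho> * (x \<bullet> (z - x))) (at_right 0)"
    unfolding DERIV_def by (simp add: filterlim_at_split)
  moreover have "eventually (\<lambda>t. (k (x + t *\<^sub>R (z - x)) - k x) / t \<le> k z - k x) (at_right 0)"
    unfolding eventually_at_right_field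
  proof (intro exI[of _ 1] conjI allI impI)
    fix t :: real assume t: "0 < t" "t < 1"
    have "k ((1 - t) *\<^sub>R x + t *\<^sub>R z) \<le> (1 - t) * k x + t * k z"
      using t x z by (intro convex_onD[OF cvx]) auto
    then have "k (x + t *\<^sub>R (z - x)) - k x \<le> t * (k z - k x)"
      by (simp add: algebra_simps)
    then show "(k (x + t *\<^sub>R (z - x)) - k x) / t \<le> k z - k x"
      using t by (simp add: field_simps)
  qed simp
  ultimately have "(z - x) \<bullet> D + \<rho> * (x \<bullet> (z - x)) \<le> k z - k x"
    by (rule tendsto_upperbound) simp
  moreover have "\<rho>/2 * (norm (z - x))\<^sup>2 = \<rho>/2 * (norm z)\<^sup>2 - \<rho>/2 * (norm x)\<^sup>2 - \<rho> * (x \<bullet> (z - x))"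
    by (simp add: power2_norm_eq_inner inner_diff inner_commute algebra_simps)
  ultimately show ?thesis
    unfolding k_def inner_commute[of D] by linarith
qed

section \<open>Recognizing gradients and Frechet subgradients\<close>

text \<open>An error quadratic in the distance vanishes after division by the distance. This is the
  form in which the Moreau envelope is differentiated.\<close>

lemma GDERIV_quadratic_error:
  fixes e :: "'a::real_inner \<Rightarrow> real"
  assumes "\<And>z. \<bar>e z - e x - v \<bullet> (z - x)\<bar> \<le> C * (norm (z - x))\<^sup>2"
  shows "GDERIV e x :> v"
  unfolding gderiv_def has_derivative_at_within
proof (intro conjI)
  show "bounded_linear (\<lambda>h. h \<bullet> v)"
    by (rule bounded_linear_inner_left)
  show "((\<lambda>z. (e z - e x - (z - x) \<bullet> v) /\<^sub>R norm (z - x)) \<longlongrightarrow> 0) (at x)"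
  proof (rule Lim_null_comparison)
    show "eventually (\<lambda>z. norm ((e z - e x - (z - x) \<bullet> v) /\<^sub>R norm (z - x)) \<le> C * norm (z - x)) (at x)"
    proof (rule eventually_at_topological[THEN iffD2], intro exI[of _ UNIV] conjI ballI impI)
      fix z assume "z \<noteq> x"
      then show "norm ((e z - e x - (z - x) \<bullet> v) /\<^sub>R norm (z - x)) \<le> C * norm (z - x)"
        using assms[of z] by (simp add: inner_commute field_simps power2_eq_square)
    qed auto
    show "((\<lambda>z. C * norm (z - x)) \<longlongrightarrow> 0) (at x)"
      by (auto intro!: tendsto_eq_intros)
  qed
qed

lemma grad_eqI:
  assumes "GDERIV g x :> D"
  shows "grad g x = D"
  unfolding grad_def
proof (rule the_equality[where P = "\<lambda>D. GDERIV g x :> D", OF assms])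
  fix D' assume "GDERIV g x :> D'"
  then have "(\<lambda>h. h \<bullet> D') = (\<lambda>h. h \<bullet> D)"
    using assms unfolding gderiv_def by (rule has_derivative_unique)
  then show "D' = D"
    by (metis vector_eq_ldot)
qed

text \<open>Off \<open>y\<close> the defining quotient is at least
  \<open>- C * norm (z - y)\<close>, which tends to 0. Where \<open>F z\<close> is \<infinity> the
  quotient is \<infinity> as well, and the value -\<infinity> is ruled out by the minorant.\<close>

lemma subdifferentialI:
  assumes fin: "\<bar>F y\<bar> \<noteq> \<infinity>"
    and ineq: "\<And>z. F z \<ge> F y + ereal (v \<bullet> (z - y) - C * (norm (z - y))\<^sup>2)"
  shows "v \<in> subdifferential F y"
proof -
  define q where "q = (\<lambda>z. (F z - F y - ereal (v \<bullet> (z - y))) / ereal (norm (z - y)))"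
  obtain a where a: "F y = ereal a" using fin by auto
  have "ereal (- C * norm (z - y)) \<le> q z" if "z \<noteq> y" for z
  proof (cases "F z")
    case (real b)
    then show ?thesis
      using ineq[of z] that by (simp add: q_def a field_simps power2_eq_square)
  next
    case PInf
    then show ?thesis
      using that by (simp add: q_def a)
  next
    case MInf
    then show ?thesis using ineq[of z] by (simp add: a)
  qed
  then have "eventually (\<lambda>z. ereal (- C * norm (z - y)) \<le> q z) (at y)"
    by (auto simp: eventually_at_topological)
  then have "Liminf (at y) (\<lambda>z. ereal (- C * norm (z - y))) \<le> Liminf (at y) q"
    by (rule Liminf_mono)
  moreover have "((\<lambda>z. ereal (- C * norm (z - y))) \<longlongrightarrow> ereal 0) (at y)"
    by (auto intro!: tendsto_eq_intros)
  then have "Liminf (at y) (\<lambda>z. ereal (- C * norm (z - y))) = 0"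
    by (simp only: lim_imp_Liminf[OF trivial_limit_at] zero_ereal_def)
  ultimately show ?thesis
    using fin by (simp add: subdifferential_def q_def)
qed

section \<open>Passage from extended-real to real convexity\<close>

lemma ereal_real_effective_domain:
  assumes "proper r" "z \<in> effective_domain r"
  shows "r z = ereal (real_of_ereal (r z))"
  using assms by (cases "r z") (auto simp: proper_def effective_domain_def)

text \<open>At two domain points the right side of the convexity inequality is finite. This puts the
  convex combination into the domain and lets the inequality be read in the reals.\<close>

lemma convex_on_effective_domain:
  assumes proper: "proper r" and convex: "convex_ereal r"
  shows "convex_on (effective_domain r) (\<lambda>z. real_of_ereal (r z))"
proof -
  let ?D = "effective_domain r"
  have "u *\<^sub>R x + v *\<^sub>R y \<in> ?D \<and>
      real_of_ereal (r (u *\<^sub>R x + v *\<^sub>R y)) \<le> u * real_of_ereal (r x) + v * real_of_ereal (r y)"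
    if "x \<in> ?D" "y \<in> ?D" "0 \<le> u" "0 \<le> v" "u + v = 1" for x y u v
  proof -
    have "r (u *\<^sub>R x + v *\<^sub>R y) \<le> ereal u * r x + ereal v * r y"
      using convex that unfolding convex_ereal_def by blast
    also have "\<dots> = ereal (u * real_of_ereal (r x) + v * real_of_ereal (r y))"
      using ereal_real_effective_domain[OF proper that(1)] ereal_real_effective_domain[OF proper that(2)]
      by (metis plus_ereal.simps(1) times_ereal.simps(1))
    finally have le: "r (u *\<^sub>R x + v *\<^sub>R y) \<le> ereal (u * real_of_ereal (r x) + v * real_of_ereal (r y))" .
    then have D: "u *\<^sub>R x + v *\<^sub>R y \<in> ?D"
      by (auto simp: effective_domain_def intro: le_less_trans)
    with le show ?thesis
      by (metis ereal_real_effective_domain proper ereal_less_eq(3))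
  qed
  then show ?thesis
    by (auto simp: convex_on_def convex_def)
qed

section \<open>Proximal points of a weakly convex plus a convex function\<close>

text \<open>Serves three functions: \<open>f\<close>, its approximation
  \<open>f\<^sub>\<eta>\<close>, and 0, which gives the proximal operator of \<open>r\<close> alone.
  Weak convexity is asked on the domain of \<open>r\<close>, since for \<open>f\<^sub>\<eta>\<close>
  it is given on \<open>X\<close> only.\<close>

locale proximal_setting =
  fixes g :: "'a::euclidean_space \<Rightarrow> real" and r :: "'a \<Rightarrow> ereal" and \<rho> :: real
  assumes continuous: "continuous_on UNIV g"
    and weakly_convex: "weakly_convex_on \<rho> (effective_domain r) g"
    and proper: "proper r"
    and convex: "convex_ereal r"
    and lsc: "lower_semicontinuous r"
    and bounded_below: "bounded_below r"
begin

abbreviation D where "D \<equiv> effective_domain r"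

text \<open>Meaningful on \<open>D\<close> only: elsewhere \<open>real_of_ereal\<close> sends
  \<infinity> to 0.\<close>

definition objective :: "'a \<Rightarrow> real" where
  "objective z = g z + real_of_ereal (r z)"

definition prox_point :: "real \<Rightarrow> 'a \<Rightarrow> 'a" where
  "prox_point \<beta> p = prox (1 / \<beta>) (\<lambda>z. ereal (g z) + r z) p"

lemmas r_eq = ereal_real_effective_domain[OF proper]

lemma ereal_objective: "z \<in> D \<Longrightarrow> ereal (g z) + r z = ereal (objective z)"
  by (subst r_eq) (auto simp: objective_def)

lemma r_eq_infinity: "z \<notin> D \<Longrightarrow> r z = \<infinity>"
  by (auto simp: effective_domain_def)

lemma convex_on_objective: "convex_on D (\<lambda>z. objective z + \<rho>/2 * (norm z)\<^sup>2)"
proof -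
  have "convex_on D (\<lambda>z. (g z + \<rho>/2 * (norm z)\<^sup>2) + real_of_ereal (r z))"
    using weakly_convex convex_on_effective_domain[OF proper convex]
    unfolding weakly_convex_on_def by (rule convex_on_add)
  then show ?thesis
    by (simp add: objective_def algebra_simps)
qed

text \<open>Splitting off the convexified \<open>g\<close>, which decreases at most linearly, and
  \<open>r\<close>, which is bounded below, leaves a quadratic with leading coefficient
  \<open>(\<beta> - \<rho>)/2 > 0\<close>. It dominates any linear term.\<close>

lemma bounded_sublevel:
  assumes \<beta>: "\<beta> > \<rho>"
  shows "bounded {z \<in> D. objective z + \<beta>/2 * (norm (z - p))\<^sup>2 \<le> c}"
proof -
  obtain x0 where x0: "x0 \<in> D"
    using proper by (auto simp: proper_def)
  have "continuous_on UNIV (\<lambda>z. g z + \<rho>/2 * (norm z)\<^sup>2)"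
    by (intro continuous_intros continuous)
  then obtain M where M: "M \<ge> 0"
    "\<And>z. z \<in> D \<Longrightarrow> g z + \<rho>/2 * (norm z)\<^sup>2 \<ge> - M - M * norm (z - x0)"
    using convex_on_linear_lower_bound[OF _ _ x0] weakly_convex
    unfolding weakly_convex_on_def by blast
  obtain m where m: "\<And>z. ereal m \<le> r z"
    using bounded_below by (auto simp: bounded_below_def)
  \<comment> \<open>\<open>a\<close> and \<open>c0\<close> are the linear and constant coefficients
    of the remaining quadratic, expanded around \<open>x0\<close>; \<open>N\<close> and
    \<open>K\<close> collect all linear and constant contributions.\<close>
  define a where "a = \<beta> *\<^sub>R (x0 - p) - \<rho> *\<^sub>R x0"
  define c0 where "c0 = \<beta>/2 * (norm (x0 - p))\<^sup>2 - \<rho>/2 * (norm x0)\<^sup>2"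
  define N where "N = M + norm a"
  define K where "K = \<bar>c - c0 + M - m\<bar>"
  have "norm (z - x0) \<le> max 1 (2 * (K + N) / (\<beta> - \<rho>))"
    if z: "z \<in> D" "objective z + \<beta>/2 * (norm (z - p))\<^sup>2 \<le> c" for z
  proof (cases "norm (z - x0) \<le> 1")
    case False
    define v where "v = z - x0"
    have v: "norm v > 1" using False by (simp add: v_def)
    have zv: "z = x0 + v" by (simp add: v_def)
    have "real_of_ereal (r z) \<ge> m"
      using m[of z] r_eq[OF z(1)] by (metis ereal_less_eq(3))
    moreover have "\<beta>/2 * (norm (z - p))\<^sup>2 - \<rho>/2 * (norm z)\<^sup>2 = (\<beta> - \<rho>)/2 * (norm v)\<^sup>2 + v \<bullet> a + c0"
      unfolding zv a_def c0_def power2_norm_eq_inner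
      by (simp add: inner_diff inner_add inner_commute field_simps)
    moreover have "v \<bullet> a \<ge> - (norm a * norm v)"
      using Cauchy_Schwarz_ineq2[of v a] by (simp add: mult.commute)
    moreover have "g z + \<rho>/2 * (norm z)\<^sup>2 \<ge> - M - M * norm v"
      using M(2)[OF z(1)] by (simp add: v_def)
    ultimately have "(\<beta> - \<rho>)/2 * (norm v)\<^sup>2 \<le> N * norm v + K"
      using z(2) unfolding objective_def N_def K_def distrib_right by linarith
    \<comment> \<open>As \<open>norm v > 1\<close>, the constant is absorbed into the linear term,
      and one factor \<open>norm v\<close> can be cancelled.\<close>
    also have "\<dots> \<le> N * norm v + K * norm v"
      using v by (simp add: K_def mult_le_cancel_left1)
    finally have "norm v * ((\<beta> - \<rho>)/2 * norm v) \<le> norm v * (K + N)"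
      by (simp add: power2_eq_square algebra_simps)
    then have "(\<beta> - \<rho>)/2 * norm v \<le> K + N"
      using v by (subst (asm) mult_le_cancel_left_pos) auto
    then have "norm v \<le> 2 * (K + N) / (\<beta> - \<rho>)"
      using \<beta> by (simp add: field_simps)
    then show ?thesis by (simp add: v_def)
  qed simp
  then show ?thesis
    unfolding bounded_def by (intro exI[of _ x0]) (auto simp: dist_norm norm_minus_commute)
qed

text \<open>\<open>prox\<close> is defined by choice, so minimality has to come from the existence
  of a minimizer: the proximal objective is lower semicontinuous with a bounded sublevel
  set.\<close>

lemma prox_point_minimal:
  assumes \<beta>: "\<beta> > \<rho>"
  shows "ereal (g (prox_point \<beta> p)) + r (prox_point \<beta> p) + ereal (\<beta>/2 * (norm (prox_point \<beta> p - p))\<^sup>2)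
    \<le> ereal (g z) + r z + ereal (\<beta>/2 * (norm (z - p))\<^sup>2)"
proof -
  define F where "F = (\<lambda>z. ereal (g z) + r z + ereal (\<beta>/2 * (norm (z - p))\<^sup>2))"
  have F: "F = (\<lambda>z. ereal (g z + \<beta>/2 * (norm (z - p))\<^sup>2) + r z)"
    unfolding F_def by (intro ext) (metis add.assoc add.commute plus_ereal.simps(1))
  obtain x0 where x0: "x0 \<in> D"
    using proper by (auto simp: proper_def)
  have FD: "F z = ereal (objective z + \<beta>/2 * (norm (z - p))\<^sup>2)" if "z \<in> D" for z
    unfolding F_def ereal_objective[OF that] by simp
  have "z \<in> D \<and> objective z + \<beta>/2 * (norm (z - p))\<^sup>2 \<le> objective x0 + \<beta>/2 * (norm (x0 - p))\<^sup>2"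
    if "F z \<le> F x0" for z
  proof -
    have "z \<in> D"
    proof (rule ccontr)
      assume "z \<notin> D"
      then have "F z = \<infinity>" by (simp add: F r_eq_infinity)
      with that show False by (simp add: FD[OF x0])
    qed
    then show ?thesis
      using that by (simp add: FD[OF x0] FD)
  qed
  then have "bounded {z. F z \<le> F x0}"
    by (intro bounded_subset[OF bounded_sublevel[OF \<beta>]]) auto
  moreover have "lower_semicontinuous F"
    unfolding F by (intro lower_semicontinuous_add_continuous lsc continuous_intros continuous)
  ultimately obtain y where "\<And>z. F y \<le> F z"
    using lower_semicontinuous_attains_inf by blast
  then have "is_arg_min F (\<lambda>_. True) y"
    by (simp add: is_arg_min_def not_less)
  then have "is_arg_min F (\<lambda>_. True) (arg_min F (\<lambda>_. True))"
    unfolding arg_min_def by (rule someI)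
  moreover have "prox_point \<beta> p = arg_min F (\<lambda>_. True)"
    by (simp add: prox_point_def prox_def F_def)
  ultimately show ?thesis
    by (simp add: is_arg_min_def not_less F_def)
qed

lemma prox_point_in_domain:
  assumes "\<beta> > \<rho>"
  shows "prox_point \<beta> p \<in> D"
proof (rule ccontr)
  assume "prox_point \<beta> p \<notin> D"
  moreover obtain x0 where "x0 \<in> D"
    using proper by (auto simp: proper_def)
  ultimately show False
    using prox_point_minimal[OF assms, of p x0] by (simp add: r_eq_infinity ereal_objective)
qed

text \<open>Compare \<open>y\<close> with the points \<open>w\<close> of the segment towards
  \<open>z\<close>, using minimality of \<open>y\<close> and convexity of the objective plus its
  quadratic. After division by \<open>t\<close> the only remaining dependence on \<open>t\<close> is
  a linear error, which vanishes as \<open>t\<close> decreases to 0.\<close>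

lemma prox_point_variational:
  fixes p
  assumes \<beta>: "\<beta> > \<rho>" and z: "z \<in> D"
  defines "y \<equiv> prox_point \<beta> p"
  shows "objective z \<ge> objective y + \<beta> * ((p - y) \<bullet> (z - y)) - \<rho>/2 * (norm (z - y))\<^sup>2"
proof -
  have y: "y \<in> D"
    unfolding y_def by (rule prox_point_in_domain[OF \<beta>])
  have bound: "objective y + \<beta> * ((p - y) \<bullet> (z - y)) - \<rho>/2 * (norm (z - y))\<^sup>2
      - t * ((\<beta> - \<rho>)/2 * (norm (z - y))\<^sup>2) \<le> objective z" if t: "0 < t" "t < 1" for t
  proof -
    define w where "w = (1 - t) *\<^sub>R y + t *\<^sub>R z"
    have w: "w \<in> D"
      unfolding w_def using convex_on_objective y z t
      by (intro convexD) (auto simp: convex_on_def)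
    have "ereal (objective y) + ereal (\<beta>/2 * (norm (y - p))\<^sup>2)
        \<le> ereal (objective w) + ereal (\<beta>/2 * (norm (w - p))\<^sup>2)"
      using prox_point_minimal[OF \<beta>, of p w] unfolding y_def[symmetric]
      by (simp only: ereal_objective[OF y] ereal_objective[OF w])
    then have "objective y + \<beta>/2 * (norm (y - p))\<^sup>2 \<le> objective w + \<beta>/2 * (norm (w - p))\<^sup>2"
      by simp
    moreover have "objective w + \<rho>/2 * (norm w)\<^sup>2
        \<le> (1 - t) * (objective y + \<rho>/2 * (norm y)\<^sup>2) + t * (objective z + \<rho>/2 * (norm z)\<^sup>2)"
      unfolding w_def using t y z by (intro convex_onD[OF convex_on_objective]) auto
    moreover have "(norm w)\<^sup>2 = (1 - t) * (norm y)\<^sup>2 + t * (norm z)\<^sup>2 - t * (1 - t) * (norm (z - y))\<^sup>2"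
      unfolding w_def power2_norm_eq_inner
      by (simp add: inner_diff inner_add inner_commute algebra_simps)
    then have "\<rho>/2 * (norm w)\<^sup>2 = \<rho>/2 * ((1 - t) * (norm y)\<^sup>2 + t * (norm z)\<^sup>2 - t * (1 - t) * (norm (z - y))\<^sup>2)"
      by simp
    moreover have "(norm (w - p))\<^sup>2
        = (norm (y - p))\<^sup>2 - 2 * t * ((p - y) \<bullet> (z - y)) + t\<^sup>2 * (norm (z - y))\<^sup>2"
      unfolding w_def power2_norm_eq_inner
      by (simp add: inner_diff inner_add inner_commute algebra_simps power2_eq_square)
    then have "\<beta>/2 * (norm (w - p))\<^sup>2
        = \<beta>/2 * ((norm (y - p))\<^sup>2 - 2 * t * ((p - y) \<bullet> (z - y)) + t\<^sup>2 * (norm (z - y))\<^sup>2)"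
      by simp
    ultimately have "t * (objective y + \<beta> * ((p - y) \<bullet> (z - y)) - \<rho>/2 * (norm (z - y))\<^sup>2
      - t * ((\<beta> - \<rho>)/2 * (norm (z - y))\<^sup>2)) \<le> t * objective z"
      by (simp add: field_simps power2_eq_square)
    then show ?thesis
      using t by simp
  qed
  show ?thesis
  proof (rule tendsto_upperbound)
    show "((\<lambda>t. objective y + \<beta> * ((p - y) \<bullet> (z - y)) - \<rho>/2 * (norm (z - y))\<^sup>2
      - t * ((\<beta> - \<rho>)/2 * (norm (z - y))\<^sup>2))
      \<longlongrightarrow> objective y + \<beta> * ((p - y) \<bullet> (z - y)) - \<rho>/2 * (norm (z - y))\<^sup>2) (at_right 0)"
      by (auto intro!: tendsto_eq_intros)
    show "eventually (\<lambda>t. objective y + \<beta> * ((p - y) \<bullet> (z - y)) - \<rho>/2 * (norm (z - y))\<^sup>2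
      - t * ((\<beta> - \<rho>)/2 * (norm (z - y))\<^sup>2) \<le> objective z) (at_right 0)"
      unfolding eventually_at_right_field using bound by (intro exI[of _ 1]) auto
  qed simp
qed

lemma moreau_envelope_eq:
  assumes "\<beta> > \<rho>"
  shows "real_of_ereal (moreau_envelope \<beta> (\<lambda>z. ereal (g z) + r z) p)
    = objective (prox_point \<beta> p) + \<beta>/2 * (norm (prox_point \<beta> p - p))\<^sup>2"
proof -
  have "moreau_envelope \<beta> (\<lambda>z. ereal (g z) + r z) p
      = ereal (g (prox_point \<beta> p)) + r (prox_point \<beta> p) + ereal (\<beta>/2 * (norm (prox_point \<beta> p - p))\<^sup>2)"
    unfolding moreau_envelope_def
    by (intro antisym INF_lower INF_greatest prox_point_minimal[OF assms]) auto
  then show ?thesis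
    by (simp add: ereal_objective[OF prox_point_in_domain[OF assms]])
qed

lemma prox_point_le_objective:
  assumes "\<beta> > \<rho>" "z \<in> D"
  shows "objective (prox_point \<beta> p) + \<beta>/2 * (norm (prox_point \<beta> p - p))\<^sup>2
    \<le> objective z + \<beta>/2 * (norm (z - p))\<^sup>2"
  using prox_point_minimal[OF assms(1), of p z]
  by (simp add: ereal_objective[OF prox_point_in_domain[OF assms(1)]] ereal_objective[OF assms(2)])

text \<open>The envelope at \<open>z\<close> is bounded above by testing with the proximal point of
  \<open>x\<close>. It is bounded below by the variational inequality at \<open>x\<close>, evaluated
  at the proximal point of \<open>z\<close>. The two bounds differ from the same affine function by
  quadratic terms.\<close>

lemma grad_moreau_envelope:
  assumes \<beta>: "\<beta> > \<rho>"
  shows "grad (\<lambda>z. real_of_ereal (moreau_envelope \<beta> (\<lambda>z. ereal (g z) + r z) z)) x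
    = \<beta> *\<^sub>R (x - prox_point \<beta> x)"
proof (rule grad_eqI, rule GDERIV_quadratic_error)
  fix z
  define e where "e = (\<lambda>z. objective (prox_point \<beta> z) + \<beta>/2 * (norm (prox_point \<beta> z - z))\<^sup>2)"
  define y where "y = prox_point \<beta> x"
  define y' where "y' = prox_point \<beta> z"
  define d where "d = y' - y"
  define a where "a = x - y"
  define h where "h = z - x"
  define \<mu> where "\<mu> = \<beta> - \<rho>"
  have \<mu>: "\<mu> > 0" using \<beta> by (simp add: \<mu>_def)
  have yx: "y - x = - a" and yz: "y - z = - a - h" and y'z: "y' - z = d - a - h" and zy: "y' - y = d"
    by (simp_all add: a_def h_def d_def)
  have dom: "y \<in> D" "y' \<in> D"
    unfolding y_def y'_def by (rule prox_point_in_domain[OF \<beta>])+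
  have "e z \<le> objective y + \<beta>/2 * (norm (y - z))\<^sup>2"
    unfolding e_def by (rule prox_point_le_objective[OF \<beta> dom(1)])
  moreover have "\<beta>/2 * (norm (y - z))\<^sup>2 = \<beta>/2 * (norm (y - x))\<^sup>2 + \<beta> * (a \<bullet> h) + \<beta>/2 * (norm h)\<^sup>2"
    unfolding yz yx power2_norm_eq_inner
    by (simp add: inner_diff inner_add inner_commute field_simps)
  ultimately have upper: "e z - e x - \<beta> * (a \<bullet> h) \<le> \<beta>/2 * (norm h)\<^sup>2"
    unfolding e_def y_def by linarith
  have "objective y' \<ge> objective y + \<beta> * (a \<bullet> d) - \<rho>/2 * (norm d)\<^sup>2"
    using prox_point_variational[OF \<beta> dom(2), of x] by (simp add: y_def[symmetric] a_def d_def)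
  moreover have "\<beta>/2 * (norm (y' - z))\<^sup>2 - \<beta>/2 * (norm (y - x))\<^sup>2
      = \<beta>/2 * (norm d)\<^sup>2 + \<beta>/2 * (norm h)\<^sup>2 - \<beta> * (a \<bullet> d) - \<beta> * (d \<bullet> h) + \<beta> * (a \<bullet> h)"
    unfolding y'z yx power2_norm_eq_inner
    by (simp add: inner_diff inner_add inner_commute field_simps)
  ultimately have lower: "e z - e x - \<beta> * (a \<bullet> h) \<ge> \<mu>/2 * (norm d)\<^sup>2 + \<beta>/2 * (norm h)\<^sup>2 - \<beta> * (d \<bullet> h)"
    unfolding e_def y_def[symmetric] y'_def[symmetric] \<mu>_def diff_divide_distrib left_diff_distrib
    by linarith
  \<comment> \<open>Completing the square eliminates the unknown displacement \<open>d\<close> of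
    the proximal point at the price of a multiple of \<open>(norm h)\<^sup>2\<close>.\<close>
  have "0 \<le> (norm (\<mu> *\<^sub>R d - \<beta> *\<^sub>R h))\<^sup>2 / (2 * \<mu>)"
    using \<mu> by simp
  also have "\<dots> = \<mu>/2 * (norm d)\<^sup>2 - \<beta> * (d \<bullet> h) + \<beta>\<^sup>2 / (2 * \<mu>) * (norm h)\<^sup>2"
    using \<mu> unfolding power2_norm_eq_inner
    by (simp add: inner_diff inner_commute field_simps power2_eq_square)
  finally have young: "\<mu>/2 * (norm d)\<^sup>2 - \<beta> * (d \<bullet> h) \<ge> - (\<beta>\<^sup>2 / (2 * \<mu>) * (norm h)\<^sup>2)"
    by simp
  \<comment> \<open>The absolute value \<open>\<bar>\<beta>\<bar>\<close> appears because
    \<open>\<beta> > \<rho>\<close> does not fix the sign of \<open>\<beta>\<close>.\<close>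
  have "\<bar>e z - e x - \<beta> * (a \<bullet> h)\<bar> \<le> (\<bar>\<beta>\<bar>/2 + \<beta>\<^sup>2 / (2 * \<mu>)) * (norm h)\<^sup>2"
  proof -
    have "\<bar>\<beta> / 2 * (norm h)\<^sup>2\<bar> = \<bar>\<beta>\<bar> / 2 * (norm h)\<^sup>2"
      by (simp add: abs_mult)
    moreover have "0 \<le> \<beta>\<^sup>2 / (2 * \<mu>) * (norm h)\<^sup>2"
      using \<mu> by simp
    ultimately show ?thesis
      using upper lower young unfolding distrib_right by linarith
  qed
  then show "\<bar>real_of_ereal (moreau_envelope \<beta> (\<lambda>z. ereal (g z) + r z) z)
      - real_of_ereal (moreau_envelope \<beta> (\<lambda>z. ereal (g z) + r z) x)
      - (\<beta> *\<^sub>R (x - prox_point \<beta> x)) \<bullet> (z - x)\<bar> \<le> (\<bar>\<beta>\<bar>/2 + \<beta>\<^sup>2 / (2 * (\<beta> - \<rho>))) * (norm (z - x))\<^sup>2"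
    by (simp add: moreau_envelope_eq[OF \<beta>] e_def a_def h_def y_def \<mu>_def)
qed

lemma prox_point_subdifferential:
  assumes \<beta>: "\<beta> > \<rho>"
  shows "\<beta> *\<^sub>R (p - prox_point \<beta> p) \<in> subdifferential (\<lambda>z. ereal (g z) + r z) (prox_point \<beta> p)"
proof (rule subdifferentialI)
  define y where "y = prox_point \<beta> p"
  have y: "y \<in> D"
    unfolding y_def by (rule prox_point_in_domain[OF \<beta>])
  show "\<bar>ereal (g (prox_point \<beta> p)) + r (prox_point \<beta> p)\<bar> \<noteq> \<infinity>"
    using ereal_objective[OF y] by (simp add: y_def)
  fix z
  have "ereal (objective y) + ereal ((\<beta> *\<^sub>R (p - y)) \<bullet> (z - y) - \<rho>/2 * (norm (z - y))\<^sup>2) \<le> ereal (g z) + r z"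
  proof (cases "z \<in> D")
    case True
    then show ?thesis
      using prox_point_variational[OF \<beta> True, of p] by (simp add: ereal_objective y_def)
  qed (simp add: r_eq_infinity)
  then show "ereal (g (prox_point \<beta> p)) + r (prox_point \<beta> p)
      + ereal ((\<beta> *\<^sub>R (p - prox_point \<beta> p)) \<bullet> (z - prox_point \<beta> p) - \<rho>/2 * (norm (z - prox_point \<beta> p))\<^sup>2)
      \<le> ereal (g z) + r z"
    unfolding y_def[symmetric] ereal_objective[OF y] .
qed

end

section \<open>Transfer of stationarity from the surrogate to the original function\<close>

text \<open>Since the surrogate \<open>f'\<close> touches \<open>f\<close> up to \<open>R\<close> at \<open>x'\<close>, the function \<open>f\<close> plus the
  quadratic \<open>\<beta>/2 * (norm (z - x'))\<^sup>2 - w \<bullet> z\<close> is almost minimal at \<open>x'\<close>; its minimizer is a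
  proximal point at \<open>x' + w / \<beta>\<close>, and strong convexity keeps it close to \<open>x'\<close>.\<close>
lemma approx_stationary_of_surrogate:
  fixes f f' :: "'a::euclidean_space \<Rightarrow> real" and r :: "'a \<Rightarrow> ereal"
  assumes "proximal_setting f r \<rho>" and \<rho>: "\<rho> \<ge> 0" and \<beta>: "\<beta> > max \<rho> \<rho>'"
    and x': "x' \<in> effective_domain r"
    and sub: "\<And>z. z \<in> effective_domain r \<Longrightarrow> f' z + real_of_ereal (r z)
      \<ge> f' x' + real_of_ereal (r x') + w \<bullet> (z - x') - \<rho>'/2 * (norm (z - x'))\<^sup>2"
    and below: "\<And>z. z \<in> effective_domain r \<Longrightarrow> f' z \<le> f z"
    and above: "f x' \<le> f' x' + R"
    and w: "norm w \<le> \<epsilon>" and x: "norm (x' - x) \<le> \<delta>"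
  shows "approx_stationary (sqrt (2 * R / (\<beta> - \<rho>)) + \<delta>) (\<epsilon> + \<beta> * sqrt (2 * R / (\<beta> - \<rho>)))
    (\<lambda>z. ereal (f z) + r z) x"
proof -
  interpret proximal_setting f r \<rho> by fact
  have \<beta>\<rho>: "\<beta> > \<rho>" "\<beta> > \<rho>'" "\<beta> > 0"
    using \<beta> \<rho> by auto
  \<comment> \<open>The shift makes the subgradient \<open>\<beta> *\<^sub>R (p - y)\<close> equal
    to \<open>w\<close> plus an error proportional to \<open>x' - y\<close>.\<close>
  define p where "p = x' + (1/\<beta>) *\<^sub>R w"
  define y where "y = prox_point \<beta> p"
  define n where "n = norm (x' - y)"
  define v where "v = w + \<beta> *\<^sub>R (x' - y)"
  have v: "\<beta> *\<^sub>R (p - y) = v"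
    using \<beta>\<rho>(3) by (simp add: p_def v_def algebra_simps)
  have y: "y \<in> D"
    unfolding y_def by (rule prox_point_in_domain[OF \<beta>\<rho>(1)])
  have "f x' + real_of_ereal (r x') \<ge> f y + real_of_ereal (r y) + (\<beta> *\<^sub>R (p - y)) \<bullet> (x' - y) - \<rho>/2 * n\<^sup>2"
    using prox_point_variational[OF \<beta>\<rho>(1) x', of p]
    by (simp add: objective_def n_def y_def)
  moreover have "(\<beta> *\<^sub>R (p - y)) \<bullet> (x' - y) = w \<bullet> (x' - y) + \<beta> * n\<^sup>2"
    by (simp add: v v_def n_def inner_add_left power2_norm_eq_inner)
  moreover have "f' y + real_of_ereal (r y) \<ge> f' x' + real_of_ereal (r x') - w \<bullet> (x' - y) - \<rho>'/2 * n\<^sup>2"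
    using sub[OF y] by (simp add: n_def norm_minus_commute inner_diff_right)
  \<comment> \<open>Adding the two inequalities, one tested at \<open>x'\<close> and the other at
    \<open>y\<close>, cancels the values of \<open>r\<close> and the products with
    \<open>w\<close>.\<close>
  ultimately have "\<beta> * n\<^sup>2 - \<rho>/2 * n\<^sup>2 - \<rho>'/2 * n\<^sup>2 \<le> R"
    using below[OF y] above by linarith
  moreover have "\<rho>'/2 * n\<^sup>2 \<le> \<beta>/2 * n\<^sup>2"
    using \<beta>\<rho>(2) by (intro mult_right_mono) auto
  ultimately have "(\<beta> - \<rho>) * n\<^sup>2 \<le> 2 * R"
    unfolding left_diff_distrib by linarith
  then have "n\<^sup>2 \<le> 2 * R / (\<beta> - \<rho>)"
    using \<beta>\<rho>(1) by (simp add: pos_le_divide_eq mult.commute)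
  then have n: "n \<le> sqrt (2 * R / (\<beta> - \<rho>))"
    by (rule real_le_rsqrt)
  have "norm (y - x) \<le> norm (x' - y) + norm (x' - x)"
    using norm_triangle_ineq4[of "x' - x" "x' - y"] by (simp add: add.commute)
  then have dist: "norm (y - x) \<le> sqrt (2 * R / (\<beta> - \<rho>)) + \<delta>"
    using n x by (simp add: n_def)
  have "norm v \<le> norm w + \<beta> * n"
    using norm_triangle_ineq[of w "\<beta> *\<^sub>R (x' - y)"] \<beta>\<rho>(3) by (simp add: v_def n_def)
  also have "\<dots> \<le> \<epsilon> + \<beta> * sqrt (2 * R / (\<beta> - \<rho>))"
    using w n \<beta>\<rho>(3) by (intro add_mono mult_left_mono) auto
  finally have "norm v \<le> \<epsilon> + \<beta> * sqrt (2 * R / (\<beta> - \<rho>))" .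
  moreover have "v \<in> subdifferential (\<lambda>z. ereal (f z) + r z) y"
    using prox_point_subdifferential[OF \<beta>\<rho>(1), of p] by (simp add: v y_def[symmetric])
  then have "dist_zero (subdifferential (\<lambda>z. ereal (f z) + r z) y) \<le> ereal (norm v)"
    unfolding dist_zero_def by (rule INF_lower2) simp
  ultimately have "dist_zero (subdifferential (\<lambda>z. ereal (f z) + r z) y)
      \<le> ereal (\<epsilon> + \<beta> * sqrt (2 * R / (\<beta> - \<rho>)))"
    by (meson ereal_less_eq(3) order_trans)
  moreover have "y \<in> effective_domain (\<lambda>z. ereal (f z) + r z)"
    using y by (simp add: effective_domain_def)
  ultimately show ?thesis
    using dist by (auto simp: approx_stationary_def)
qed

section \<open>Stationarity from the proximal gradient step and from the Moreau envelope\<close>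

theorem theorem3p2:
  fixes f f\<^sub>\<eta> :: "'a::euclidean_space \<Rightarrow> real"
    and r \<phi> \<phi>\<^sub>\<eta> :: "'a \<Rightarrow> ereal"
    and R\<^sub>\<eta> :: "'a \<Rightarrow> real" and L\<^sub>\<eta> :: "'a \<Rightarrow> 'a \<Rightarrow> real"
    and X :: "'a set" and \<rho> \<rho>' :: real and x :: 'a
  assumes "\<rho> > 0" and "weakly_convex_on \<rho> UNIV f"
    and "proper r" and "convex_ereal r" and "lower_semicontinuous r" and "bounded_below r"
    and "closed X" and "convex X" and "effective_domain r \<subseteq> X"
    and "smooth_approximation \<rho>' R\<^sub>\<eta> L\<^sub>\<eta> X f\<^sub>\<eta> f"
    and "\<phi> = (\<lambda>z. ereal (f z) + r z)" and "\<phi>\<^sub>\<eta> = (\<lambda>z. ereal (f\<^sub>\<eta> z) + r z)"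
    and "x \<in> effective_domain \<phi>"
  shows
    "(\<forall>\<gamma> > 0. \<forall>\<epsilon> > 0.
        let x\<^sub>h = prox \<gamma> r (x - \<gamma> *\<^sub>R grad f\<^sub>\<eta> x);
            G = (1 / \<gamma>) *\<^sub>R (x - x\<^sub>h)
        in norm G \<le> \<epsilon> \<longrightarrow>
           (\<forall>\<rho>\<^sub>h > max \<rho> \<rho>'.
              approx_stationary
                (sqrt (2 * R\<^sub>\<eta> x\<^sub>h / (\<rho>\<^sub>h - \<rho>)) + \<gamma> * \<epsilon>)
                ((1 + \<gamma> * L\<^sub>\<eta> x x\<^sub>h) * \<epsilon> + \<rho>\<^sub>h * sqrt (2 * R\<^sub>\<eta> x\<^sub>h / (\<rho>\<^sub>h - \<rho>)))
                \<phi> x)) \<and>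
     (\<forall>\<beta> > max \<rho> \<rho>'. \<forall>\<epsilon>.
        let y\<^sub>x = prox (1 / \<beta>) \<phi>\<^sub>\<eta> x
        in norm (grad (\<lambda>z. real_of_ereal (moreau_envelope \<beta> \<phi>\<^sub>\<eta> z)) x) \<le> \<epsilon> \<longrightarrow>
           approx_stationary
             (sqrt (2 * R\<^sub>\<eta> y\<^sub>x / (\<beta> - \<rho>)) + (1 / \<beta>) * \<epsilon>)
             (\<beta> * sqrt (2 * R\<^sub>\<eta> y\<^sub>x / (\<beta> - \<rho>)) + \<epsilon>)
             \<phi> x)"
proof -
  let ?D = "effective_domain r"
  have approx: "continuously_differentiable f\<^sub>\<eta>" "weakly_convex_on \<rho>' X f\<^sub>\<eta>"
    "\<And>z. z \<in> X \<Longrightarrow> f\<^sub>\<eta> z \<le> f z" "\<And>z. z \<in> X \<Longrightarrow> f z \<le> f\<^sub>\<eta> z + R\<^sub>\<eta> z"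
    "\<And>y z. y \<in> X \<Longrightarrow> z \<in> X \<Longrightarrow> norm (grad f\<^sub>\<eta> y - grad f\<^sub>\<eta> z) \<le> L\<^sub>\<eta> y z * norm (y - z)"
    "\<And>y z. y \<in> X \<Longrightarrow> z \<in> X \<Longrightarrow> L\<^sub>\<eta> y z \<ge> 0"
    using assms(10) by (auto simp: smooth_approximation_def)
  have gderiv: "GDERIV f\<^sub>\<eta> z :> grad f\<^sub>\<eta> z" for z
    using approx(1) by (simp add: continuously_differentiable_def)
  have r_props: "proper r" "convex_ereal r" "lower_semicontinuous r" "bounded_below r"
    using assms by auto
  have convex_D: "convex ?D"
    using convex_on_effective_domain[OF r_props(1,2)] by (simp add: convex_on_def)
  \<comment> \<open>With modulus 0 the variational inequality for \<open>r\<close> carries no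
    quadratic loss.\<close>
  interpret zero: proximal_setting "\<lambda>_. 0" r 0
    by standard (use r_props convex_D in \<open>auto simp: weakly_convex_on_def convex_on_def\<close>)
  have f: "proximal_setting f r \<rho>"
  proof
    \<comment> \<open>A finite convex function on the whole space is continuous; subtracting the
      quadratic gives continuity of \<open>f\<close>.\<close>
    have "continuous_on UNIV (\<lambda>z. f z + \<rho>/2 * (norm z)\<^sup>2)"
      using assms(2) by (intro convex_on_continuous) (auto simp: weakly_convex_on_def)
    then have "continuous_on UNIV (\<lambda>z. (f z + \<rho>/2 * (norm z)\<^sup>2) - \<rho>/2 * (norm z)\<^sup>2)"
      by (rule continuous_on_diff) (intro continuous_intros)
    then show "continuous_on UNIV f" by (simp only: add_diff_cancel_right')
    show "weakly_convex_on \<rho> ?D f"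
      using assms(2) convex_D unfolding weakly_convex_on_def by (auto intro: convex_on_subset)
  qed (use r_props in auto)
  interpret surrogate: proximal_setting f\<^sub>\<eta> r \<rho>'
  proof
    show "continuous_on UNIV f\<^sub>\<eta>"
      using gderiv unfolding gderiv_def
      by (intro continuous_at_imp_continuous_on ballI has_derivative_continuous) blast
    show "weakly_convex_on \<rho>' ?D f\<^sub>\<eta>"
      using approx(2) assms(9) convex_D unfolding weakly_convex_on_def by (auto intro: convex_on_subset)
  qed (use r_props in auto)
  have x: "x \<in> X"
    using assms(9,11,13) by (auto simp: effective_domain_def)
  note D_X = subsetD[OF assms(9)]
  have part1: "approx_stationary
      (sqrt (2 * R\<^sub>\<eta> x' / (\<beta> - \<rho>)) + \<gamma> * \<epsilon>)
      ((1 + \<gamma> * L\<^sub>\<eta> x x') * \<epsilon> + \<beta> * sqrt (2 * R\<^sub>\<eta> x' / (\<beta> - \<rho>))) \<phi> x"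
    if \<gamma>: "\<gamma> > 0" and x'_def: "x' = prox \<gamma> r (x - \<gamma> *\<^sub>R grad f\<^sub>\<eta> x)"
      and G: "norm ((1 / \<gamma>) *\<^sub>R (x - x')) \<le> \<epsilon>" and \<beta>: "\<beta> > max \<rho> \<rho>'" for \<gamma> \<epsilon> \<beta> x'
  proof -
    \<comment> \<open>The proximal step makes \<open>w - grad f\<^sub>\<eta> x'\<close> a
      subgradient of \<open>r\<close> at \<open>x'\<close>. Exchanging the gradient at
      \<open>x\<close> for the one at \<open>x'\<close> thus makes \<open>w\<close> the slope of a
      quadratic minorant of \<open>\<phi>\<^sub>\<eta>\<close> at \<open>x'\<close>.\<close>
    define w where "w = (1/\<gamma>) *\<^sub>R (x - x') + grad f\<^sub>\<eta> x' - grad f\<^sub>\<eta> x"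
    have x'_prox: "x' = zero.prox_point (1/\<gamma>) (x - \<gamma> *\<^sub>R grad f\<^sub>\<eta> x)"
      by (simp add: zero.prox_point_def x'_def zero_ereal_def[symmetric])
    have D: "x' \<in> ?D"
      unfolding x'_prox using \<gamma> by (intro zero.prox_point_in_domain) simp
    have dist: "norm (x - x') \<le> \<gamma> * \<epsilon>"
    proof -
      have "norm (x - x') / \<gamma> \<le> \<epsilon>"
        using G \<gamma> by simp
      then show ?thesis
        using \<gamma> by (simp add: pos_divide_le_eq mult.commute)
    qed
    show ?thesis
      unfolding assms(11)
    proof (rule approx_stationary_of_surrogate[OF f _ \<beta> D, where f' = f\<^sub>\<eta> and w = w])
      show "f\<^sub>\<eta> x' + real_of_ereal (r x') + w \<bullet> (z - x') - \<rho>'/2 * (norm (z - x'))\<^sup>2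
          \<le> f\<^sub>\<eta> z + real_of_ereal (r z)" if z: "z \<in> ?D" for z
      proof -
        have "real_of_ereal (r x') + (1/\<gamma>) * ((x - \<gamma> *\<^sub>R grad f\<^sub>\<eta> x - x') \<bullet> (z - x')) \<le> real_of_ereal (r z)"
          using zero.prox_point_variational[of "1/\<gamma>" z "x - \<gamma> *\<^sub>R grad f\<^sub>\<eta> x"] z \<gamma>
          by (simp add: x'_prox[symmetric] zero.objective_def)
        moreover have "(1/\<gamma>) * ((x - \<gamma> *\<^sub>R grad f\<^sub>\<eta> x - x') \<bullet> (z - x')) = (w - grad f\<^sub>\<eta> x') \<bullet> (z - x')"
          using \<gamma> by (simp add: w_def inner_diff_left inner_add_left field_simps)
        moreover have "f\<^sub>\<eta> x' + grad f\<^sub>\<eta> x' \<bullet> (z - x') - \<rho>'/2 * (norm (z - x'))\<^sup>2 \<le> f\<^sub>\<eta> z"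
          using weakly_convex_gradient_inequality[OF approx(2) gderiv D_X[OF D] D_X[OF z]] .
        ultimately show ?thesis
          unfolding inner_diff_left[of w] by linarith
      qed
      have "norm w \<le> norm ((1/\<gamma>) *\<^sub>R (x - x')) + norm (grad f\<^sub>\<eta> x - grad f\<^sub>\<eta> x')"
        using norm_triangle_ineq4[of "(1/\<gamma>) *\<^sub>R (x - x')" "grad f\<^sub>\<eta> x - grad f\<^sub>\<eta> x'"]
        by (simp add: w_def algebra_simps)
      \<comment> \<open>The gradient difference is at most
        \<open>L\<^sub>\<eta> x x' * norm (x - x')\<close>, and the step length is at most
        \<open>\<gamma> * \<epsilon>\<close>.\<close>
      also have "\<dots> \<le> \<epsilon> + L\<^sub>\<eta> x x' * (\<gamma> * \<epsilon>)"
        using approx(5)[OF x D_X[OF D]] mult_left_mono[OF dist approx(6)[OF x D_X[OF D]]] G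
        by linarith
      finally show "norm w \<le> (1 + \<gamma> * L\<^sub>\<eta> x x') * \<epsilon>"
        by (simp add: algebra_simps)
    qed (use assms(1) approx D_X D dist in \<open>auto simp: norm_minus_commute\<close>)
  qed
  have part2: "approx_stationary
      (sqrt (2 * R\<^sub>\<eta> y / (\<beta> - \<rho>)) + (1 / \<beta>) * \<epsilon>)
      (\<beta> * sqrt (2 * R\<^sub>\<eta> y / (\<beta> - \<rho>)) + \<epsilon>) \<phi> x"
    if \<beta>: "\<beta> > max \<rho> \<rho>'" and y_def: "y = prox (1 / \<beta>) \<phi>\<^sub>\<eta> x"
      and G: "norm (grad (\<lambda>z. real_of_ereal (moreau_envelope \<beta> \<phi>\<^sub>\<eta> z)) x) \<le> \<epsilon>" for \<beta> \<epsilon> y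
  proof -
    have \<beta>': "\<beta> > \<rho>'" "\<beta> > 0"
      using \<beta> assms(1) by auto
    have y_prox: "y = surrogate.prox_point \<beta> x"
      by (simp add: surrogate.prox_point_def y_def assms(12))
    have D: "y \<in> ?D"
      unfolding y_prox by (rule surrogate.prox_point_in_domain[OF \<beta>'(1)])
    \<comment> \<open>Here the slope of the minorant is the gradient of the envelope itself, so no
      gradient difference enters the bound.\<close>
    have w: "norm (\<beta> *\<^sub>R (x - y)) \<le> \<epsilon>"
      using G unfolding assms(12) surrogate.grad_moreau_envelope[OF \<beta>'(1)] y_prox .
    have "approx_stationary (sqrt (2 * R\<^sub>\<eta> y / (\<beta> - \<rho>)) + (1 / \<beta>) * \<epsilon>)
        (\<epsilon> + \<beta> * sqrt (2 * R\<^sub>\<eta> y / (\<beta> - \<rho>))) \<phi> x"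
      unfolding assms(11)
    proof (rule approx_stationary_of_surrogate[OF f _ \<beta> D, where f' = f\<^sub>\<eta> and w = "\<beta> *\<^sub>R (x - y)"])
      show "f\<^sub>\<eta> y + real_of_ereal (r y) + (\<beta> *\<^sub>R (x - y)) \<bullet> (z - y) - \<rho>'/2 * (norm (z - y))\<^sup>2
          \<le> f\<^sub>\<eta> z + real_of_ereal (r z)" if "z \<in> ?D" for z
        using surrogate.prox_point_variational[OF \<beta>'(1) that, of x]
        by (simp add: y_prox[symmetric] surrogate.objective_def)
      show "norm (y - x) \<le> (1 / \<beta>) * \<epsilon>"
      proof -
        have "\<beta> * norm (x - y) \<le> \<epsilon>"
          using w \<beta>'(2) by simp
        then show ?thesis
          using \<beta>'(2) by (simp add: norm_minus_commute pos_le_divide_eq mult.commute)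
      qed
    qed (use assms(1) approx D_X D w in auto)
    then show ?thesis
      by (simp add: add.commute)
  qed
  show ?thesis
    unfolding Let_def using part1 part2 by blast
qed

end
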